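(* Let $n\ge1$ and let $(\xi_i,\mathcal{F}_i)_{i=0,\dots,n}$ be real-valued supermartingale differences with $S_k=\sum_{i=1}^k\xi_i$ and $\langle S\rangle_k=\sum_{i=1}^k\mathbf{E}(\xi_i^2|\mathcal{F}_{i-1})$. Let $U_{i-1}$, $i\in[1,n]$, be nonnegative $\mathcal{F}_{i-1}$-measurable random variables, and set $$C_{i-1}^2=\begin{cases}\mathbf{E}(\xi_i^2|\mathcal{F}_{i-1}), & \text{if } \mathbf{E}(\xi_i^2|\mathcal{F}_{i-1})\ge U_{i-1}^2,\\[4pt] \dfrac14\left(U_{i-1}+\dfrac{\mathbf{E}(\xi_i^2|\mathcal{F}_{i-1})}{U_{i-1}}\right)^2, & \text{otherwise.}\end{cases}$$ If $\xi_i\le U_{i-1}$ for all $i\in[1,n]$, then, for all $\lambda>0$ and all $i\in[1,n]$, $$\mathbf{E}(e^{\lambda\xi_i}|\mathcal{F}_{i-1})\le\exp\left\{\frac{\lambda^2}{2}C_{i-1}^2\right\},$$ and, for all $x,v>0$, $$\mathbf{P}\left(S_k\ge x\ \text{and}\ \sum_{i=1}^kC_{i-1}^2\le v^2\ \text{for some}\ k\in[1,n]\right)\le\exp\left\{-\frac{x^2}{2v^2}\right\}.$$ In particular, if moreover $\mathbf{E}(\xi_i^2|\mathcal{F}_{i-1})\ge U_{i-1}^2$ for all $i\in[1,n]$, then, for all $x\ge0$ and $v>0$, $$\mathbf{P}\left(\max_{1\le k\le n}S_k\ge x\ \text{and}\ \langle S\rangle_n\le v^2\right)\le\exp\left\{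-\frac{x^2}{2v^2}\right\}.$$
   Context: $(\xi_i,\mathcal{F}_i)_{i=0,\dots,n}$ is a sequence of real-valued supermartingale differences on a probability space $(\Omega,\mathcal{F},\mathbf{P})$: $\xi_0=0$, $\{\emptyset,\Omega\}=\mathcal{F}_0\subseteq\dots\subseteq\mathcal{F}_n\subseteq\mathcal{F}$ are increasing $\sigma$-fields, $\xi_i$ is $\mathcal{F}_i$-measurable, and $\mathbf{E}(\xi_i|\mathcal{F}_{i-1})\le 0$ for $i=1,\dots,n$. Here $i,k\in[1,n]$ denote integers. Inequalities between conditional expectations hold almost surely. *)

theory Defs
  imports "HOL-Probability.Probability"
begin

definition supermartingale_differences ::
    "'a measure \<Rightarrow> nat \<Rightarrow> (nat \<Rightarrow> 'a measure) \<Rightarrow> (nat \<Rightarrow> 'a \<Rightarrow> real) \<Rightarrow> bool" where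
  "supermartingale_differences M n F \<xi> \<longleftrightarrow>
     prob_space M \<and>
     (\<forall>i\<le>n. subalgebra M (F i)) \<and>
     sets (F 0) = {{}, space M} \<and>
     (\<forall>i<n. sets (F i) \<subseteq> sets (F (Suc i))) \<and>
     (\<forall>\<omega>\<in>space M. \<xi> 0 \<omega> = 0) \<and>
     (\<forall>i\<le>n. \<xi> i \<in> borel_measurable (F i)) \<and>
     (\<forall>i\<in>{1..n}. integrable M (\<xi> i)) \<and>
     (\<forall>i\<in>{1..n}. AE \<omega> in M. real_cond_exp M (F (i - 1)) (\<xi> i) \<omega> \<le> 0)"

(* The variables xi_i are only assumed integrable, so the conditional expectations of the
   nonnegative variables xi_i^2 and exp (l * xi_i) may be infinite: they are taken in [0, \<infinity>].
   (real_cond_exp would silently replace an infinite value by 0.) *)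

definition cond_second_moment ::
    "'a measure \<Rightarrow> (nat \<Rightarrow> 'a measure) \<Rightarrow> (nat \<Rightarrow> 'a \<Rightarrow> real) \<Rightarrow> nat \<Rightarrow> 'a \<Rightarrow> ennreal" where
  "cond_second_moment M F \<xi> i = nn_cond_exp M (F (i - 1)) (\<lambda>\<omega>. ennreal ((\<xi> i \<omega>)\<^sup>2))"

definition partial_sum :: "(nat \<Rightarrow> 'a \<Rightarrow> real) \<Rightarrow> nat \<Rightarrow> 'a \<Rightarrow> real" where
  "partial_sum \<xi> k \<omega> = (\<Sum>i=1..k. \<xi> i \<omega>)"

definition quad_char ::
    "'a measure \<Rightarrow> (nat \<Rightarrow> 'a measure) \<Rightarrow> (nat \<Rightarrow> 'a \<Rightarrow> real) \<Rightarrow> nat \<Rightarrow> 'a \<Rightarrow> ennreal" where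
  "quad_char M F \<xi> k \<omega> = (\<Sum>i=1..k. cond_second_moment M F \<xi> i \<omega>)"

(* C_sq M F \<xi> U j is the variable C_j^2; as C_{i-1}^2 belongs to xi_i, the index j involves
   xi_{j+1}. For U j \<omega> \<ge> 0 the second branch is reached only if U j \<omega> > 0 and the
   conditional second moment is finite, so the quotient there is a genuine one. *)
definition C_sq ::
    "'a measure \<Rightarrow> (nat \<Rightarrow> 'a measure) \<Rightarrow> (nat \<Rightarrow> 'a \<Rightarrow> real) \<Rightarrow> (nat \<Rightarrow> 'a \<Rightarrow> real) \<Rightarrow>
     nat \<Rightarrow> 'a \<Rightarrow> ennreal" where
  "C_sq M F \<xi> U j \<omega> =
     (if cond_second_moment M F \<xi> (j + 1) \<omega> \<ge> ennreal ((U j \<omega>)\<^sup>2)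
      then cond_second_moment M F \<xi> (j + 1) \<omega>
      else ennreal (1 / 4) *
        (ennreal (U j \<omega>) + cond_second_moment M F \<xi> (j + 1) \<omega> / ennreal (U j \<omega>))\<^sup>2)"

definition exp_ennreal :: "ennreal \<Rightarrow> ennreal" where
  "exp_ennreal t = (if t = \<infinity> then \<infinity> else ennreal (exp (enn2real t)))"

end

theory Submission
  imports Defs
begin

text \<open>
  Write \<open>\<sigma>\<^sup>2\<close> for the conditional second moment of \<open>\<xi>\<close> and set \<open>b = max U \<sigma>\<close>, \<open>a = \<sigma>\<^sup>2 / b\<close>.
  In both branches of its definition \<open>C\<close> equals \<open>(a + b) / 2\<close>. On \<open>(-\<infinity>, b]\<close> the function
  \<open>exp (l x)\<close> lies below the parabola touching it at \<open>-a\<close> and meeting it at \<open>b\<close>; the conditional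
  expectation of this parabola at \<open>\<xi>\<close> is at most its mean under the centred law on \<open>{-a, b}\<close>, which
  Hoeffding's lemma bounds by \<open>exp (l\<^sup>2 (a + b)\<^sup>2 / 8)\<close>. Hence \<open>exp (l S - l\<^sup>2 / 2 \<Sum> C\<^sup>2)\<close> is a
  nonnegative supermartingale, and the maximal inequality with \<open>l = x / v\<^sup>2\<close> gives the tail bound.
\<close>

section \<open>Majorising the exponential by a parabola\<close>

text \<open>The value 1/2 is the limit of the quotient at 0; it makes \<open>exp_le_parabola\<close>
  true at \<open>h = 0\<close>.\<close>

definition exp_remainder :: "real \<Rightarrow> real" where
  "exp_remainder t = (if t = 0 then 1 / 2 else (exp t - 1 - t) / t\<^sup>2)"

lemma exp_remainder_measurable [measurable]: "exp_remainder \<in> borel_measurable borel"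
  unfolding exp_remainder_def by measurable

lemma exp_eq_remainder: "exp t = 1 + t + t\<^sup>2 * exp_remainder t"
  by (simp add: exp_remainder_def)

lemma exp_remainder_nonneg: "0 \<le> exp_remainder t"
proof -
  have "0 \<le> exp t - 1 - t" using exp_ge_add_one_self[of t] by linarith
  then show ?thesis by (simp add: exp_remainder_def)
qed

text \<open>The derivative \<open>exp t - 1 - t\<close> is nonnegative on the whole line. As the
  function vanishes at 0, comparison with 0 gives \<open>exp y \<le> 1 + y + y\<^sup>2 / 2\<close>
  for \<open>y \<le> 0\<close>, and the lower bound 1/2 for \<open>exp_remainder h\<close> when
  \<open>0 \<le> h\<close>.\<close>

lemma exp_minus_quadratic_mono:
  fixes x y :: real
  assumes "x \<le> y"
  shows "exp x - 1 - x - x\<^sup>2 / 2 \<le> exp y - 1 - y - y\<^sup>2 / 2"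
proof (rule DERIV_nonneg_imp_nondecreasing[OF assms])
  fix t :: real
  have "((\<lambda>t. exp t - 1 - t - t\<^sup>2 / 2) has_real_derivative exp t - 1 - t) (at t)"
    by (auto intro!: derivative_eq_intros)
  moreover have "0 \<le> exp t - 1 - t" using exp_ge_add_one_self[of t] by linarith
  ultimately show "\<exists>D. ((\<lambda>t. exp t - 1 - t - t\<^sup>2 / 2) has_real_derivative D) (at t) \<and> 0 \<le> D"
    by blast
qed

lemma exp_remainder_mono_pos:
  assumes "0 < y" "y \<le> h"
  shows "exp_remainder y \<le> exp_remainder h"
proof -
  \<comment> \<open>This is the numerator of the derivative of the quotient, after a factor
    \<open>t\<close> is cancelled. It vanishes at 0 and increases because
    \<open>1 - u \<le> exp (- u)\<close>.\<close>
  have num: "0 \<le> (t - 2) * exp t + t + 2" if "0 \<le> t" for t :: real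
  proof -
    have "(0 - 2) * exp 0 + 0 + 2 \<le> (t - 2) * exp t + t + (2::real)"
    proof (rule DERIV_nonneg_imp_nondecreasing[OF that])
      fix u :: real
      have "((\<lambda>u. (u - 2) * exp u + u + 2) has_real_derivative (u - 1) * exp u + 1) (at u)"
        by (auto intro!: derivative_eq_intros simp: algebra_simps)
      moreover have "(1 - u) * exp u \<le> exp (- u) * exp u"
        using exp_ge_add_one_self[of "- u"] by (intro mult_right_mono) auto
      then have "0 \<le> (u - 1) * exp u + 1"
        by (simp add: exp_minus algebra_simps)
      ultimately show "\<exists>D. ((\<lambda>u. (u - 2) * exp u + u + 2) has_real_derivative D) (at u) \<and> 0 \<le> D"
        by blast
    qed
    then show ?thesis by simp
  qed
  have "(exp y - 1 - y) / y\<^sup>2 \<le> (exp h - 1 - h) / h\<^sup>2"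
  proof (rule DERIV_nonneg_imp_nondecreasing[OF assms(2)])
    fix t assume "y \<le> t" "t \<le> h"
    with assms have t: "0 < t" by simp
    then have "((\<lambda>t. (exp t - 1 - t) / t\<^sup>2) has_real_derivative
        ((t - 2) * exp t + t + 2) / t ^ 3) (at t)"
      by (auto intro!: derivative_eq_intros simp: field_simps power2_eq_square power3_eq_cube)
    moreover have "0 \<le> ((t - 2) * exp t + t + 2) / t ^ 3"
      using num[of t] t by simp
    ultimately
    show "\<exists>D. ((\<lambda>t. (exp t - 1 - t) / t\<^sup>2) has_real_derivative D) (at t) \<and> 0 \<le> D"
      by blast
  qed
  with assms show ?thesis by (simp add: exp_remainder_def)
qed

text \<open>For positive \<open>y\<close>, monotonicity replaces \<open>exp_remainder y\<close> by
  \<open>exp_remainder h\<close>. For \<open>y \<le> 0\<close> the coefficient 1/2 already suffices,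
  and \<open>exp_remainder h\<close> is at least 1/2.\<close>

lemma exp_le_parabola:
  assumes "0 \<le> h" "y \<le> h"
  shows "exp y \<le> 1 + y + y\<^sup>2 * exp_remainder h"
proof -
  have half: "1 / 2 \<le> exp_remainder h"
    using exp_minus_quadratic_mono[of 0 h] assms(1) by (simp add: exp_remainder_def field_simps)
  show ?thesis
  proof (cases "y \<le> 0")
    case True
    have "exp y \<le> 1 + y + y\<^sup>2 * (1 / 2)"
      using exp_minus_quadratic_mono[OF True] by simp
    also have "\<dots> \<le> 1 + y + y\<^sup>2 * exp_remainder h"
      using half by (intro add_left_mono mult_left_mono) auto
    finally show ?thesis .
  next
    case False
    then have "y\<^sup>2 * exp_remainder y \<le> y\<^sup>2 * exp_remainder h"
      using assms by (intro mult_left_mono exp_remainder_mono_pos) auto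
    then show ?thesis using exp_eq_remainder[of y] by simp
  qed
qed

text \<open>For \<open>p \<le> 1\<close> the left side is the mean of \<open>exp Y\<close>, where
  \<open>Y\<close> equals \<open>(1 - p) * h\<close> with probability \<open>p\<close> and
  \<open>- (p * h)\<close> otherwise. Taking logarithms leaves the analytic inequality behind
  Hoeffding's lemma.\<close>

lemma two_point_mgf_le:
  fixes p h :: real
  assumes "0 \<le> p" "0 \<le> h"
  shows "exp (- (p * h)) * (1 + p * (exp h - 1)) \<le> exp (h\<^sup>2 / 8)"
proof -
  have pos: "0 < 1 + p * (exp h - 1)"
    using assms by (intro add_pos_nonneg mult_nonneg_nonneg) auto
  have "exp (- (p * h)) * (1 + p * (exp h - 1)) = exp (- h * p + ln (1 + p * (exp h - 1)))"
    unfolding exp_add exp_ln[OF pos] by (simp add: mult.commute)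
  also have "\<dots> \<le> exp (h\<^sup>2 / 8)"
    using Hoeffdings_lemma_aux[OF assms(2,1)] by simp
  finally show ?thesis .
qed

text \<open>The parabola agrees with \<open>exp (l * x)\<close> at \<open>x = - a\<close> and
  \<open>x = b\<close>. Hence its mean under the centred law on these two points, whose variance is
  \<open>a * b\<close>, is the moment generating function of that law; centring removes the linear
  term.\<close>

lemma parabola_mean_le:
  fixes a b l s :: real
  assumes "0 \<le> a" "0 \<le> b" "s = a * b" "0 < l"
  defines "h \<equiv> l * (a + b)"
  shows "exp (- (l * a)) * (1 + l * a + l\<^sup>2 * a\<^sup>2 * exp_remainder h)
           + exp (- (l * a)) * l\<^sup>2 * exp_remainder h * s \<le> exp (h\<^sup>2 / 8)"
proof (cases "a + b = 0")
  case True
  with assms have "a = 0" "b = 0" by auto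
  with assms show ?thesis by simp
next
  case False
  \<comment> \<open>The mass that the centred law on \<open>- a\<close> and \<open>b\<close> gives
    to \<open>b\<close>.\<close>
  define p where "p = a / (a + b)"
  have h: "0 \<le> h" "0 \<le> p" using assms by (auto simp: p_def h_def)
  have ph: "p * h = l * a" using False by (simp add: p_def h_def)
  have "l\<^sup>2 * a\<^sup>2 + l\<^sup>2 * s = (l * a) * (l * (a + b))"
    unfolding assms(3) by (simp add: algebra_simps power2_eq_square)
  also have "\<dots> = p * h\<^sup>2"
    unfolding ph[symmetric] by (simp add: h_def power2_eq_square)
  finally have *: "l\<^sup>2 * a\<^sup>2 + l\<^sup>2 * s = p * h\<^sup>2" .
  have "exp (- (l * a)) * (1 + l * a + l\<^sup>2 * a\<^sup>2 * exp_remainder h)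
           + exp (- (l * a)) * l\<^sup>2 * exp_remainder h * s =
        exp (- (l * a)) * (1 + l * a + (l\<^sup>2 * a\<^sup>2 + l\<^sup>2 * s) * exp_remainder h)"
    by (simp add: algebra_simps)
  also have "\<dots> = exp (- (p * h)) * (1 + p * (h + h\<^sup>2 * exp_remainder h))"
    unfolding * ph[symmetric] by (simp add: algebra_simps)
  also have "\<dots> = exp (- (p * h)) * (1 + p * (exp h - 1))"
    using exp_eq_remainder[of h] by simp
  also have "\<dots> \<le> exp (h\<^sup>2 / 8)"
    by (rule two_point_mgf_le) (use h in auto)
  finally show ?thesis .
qed

text \<open>The maximum merges the branches: if \<open>b = sqrt s\<close>, then \<open>s / b\<close>
  is \<open>sqrt s\<close> again and the formula collapses to \<open>s\<close>; if
  \<open>b = U j \<omega>\<close>, it is the second branch. When \<open>b = 0\<close>, the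
  convention \<open>0 / 0 = 0\<close> gives the correct value 0.\<close>

lemma C_sq_eq:
  assumes "cond_second_moment M F \<xi> (j + 1) \<omega> = ennreal s" "0 \<le> s" "0 \<le> U j \<omega>"
  defines "b \<equiv> max (U j \<omega>) (sqrt s)"
  shows "C_sq M F \<xi> U j \<omega> = ennreal ((s / b + b)\<^sup>2 / 4)"
proof (cases "(U j \<omega>)\<^sup>2 \<le> s")
  case True
  then have "U j \<omega> \<le> sqrt s" by (rule real_le_rsqrt)
  then have b: "b = sqrt s" by (simp add: b_def)
  have "s / b + b = 2 * sqrt s" using assms(2) by (simp add: b real_div_sqrt)
  then have "(s / b + b)\<^sup>2 / 4 = s" using assms(2) by (simp add: power_mult_distrib)
  then show ?thesis using True assms by (simp add: C_sq_def)
next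
  case False
  then have "sqrt s < U j \<omega>" by (simp add: assms(3) real_less_lsqrt assms(2))
  then have b: "b = U j \<omega>" and pos: "0 < U j \<omega>"
    using assms(2) real_sqrt_ge_zero[of s] by (auto simp: b_def simp del: real_sqrt_ge_0_iff)
  have "C_sq M F \<xi> U j \<omega> = ennreal (1 / 4) * (ennreal (U j \<omega>) + ennreal s / ennreal (U j \<omega>))\<^sup>2"
    unfolding C_sq_def assms(1) using False assms(2,3) by simp
  also have "\<dots> = ennreal (1 / 4) * (ennreal (U j \<omega> + s / U j \<omega>))\<^sup>2"
    using pos assms(2) by (simp add: divide_ennreal)
  also have "\<dots> = ennreal (1 / 4 * (U j \<omega> + s / U j \<omega>)\<^sup>2)"
    using pos assms(2) by (subst ennreal_mult) (auto simp: ennreal_power simp del: ennreal_plus)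
  finally show ?thesis by (simp add: b add.commute)
qed

section \<open>Conditional expectation of a parabola\<close>

context sigma_finite_subalgebra
begin

text \<open>\<open>real_cond_exp\<close> subtracts the conditional expectations of the two parts of
  \<open>X\<close> after \<open>enn2real\<close>, which sends infinity to 0. Integrability makes
  both finite almost surely, so the sign of the difference can be read back in
  \<open>ennreal\<close>.\<close>

lemma nn_cond_exp_parts_le:
  assumes X: "integrable M X" and neg: "AE \<omega> in M. real_cond_exp M F X \<omega> \<le> 0"
  shows "AE \<omega> in M. nn_cond_exp M F (\<lambda>\<omega>. ennreal (X \<omega>)) \<omega> \<le> nn_cond_exp M F (\<lambda>\<omega>. ennreal (- X \<omega>)) \<omega>
           \<and> nn_cond_exp M F (\<lambda>\<omega>. ennreal (- X \<omega>)) \<omega> < \<infinity>"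
proof -
  have fin: "AE \<omega> in M. nn_cond_exp M F (\<lambda>\<omega>. ennreal (Y \<omega>)) \<omega> \<noteq> \<infinity>" if Y: "integrable M Y" for Y
  proof (rule nn_integral_PInf_AE)
    have [measurable]: "Y \<in> borel_measurable M" using Y by auto
    have "(\<integral>\<^sup>+ \<omega>. nn_cond_exp M F (\<lambda>\<omega>. ennreal (Y \<omega>)) \<omega> \<partial>M) = (\<integral>\<^sup>+ \<omega>. ennreal (Y \<omega>) \<partial>M)"
      using nn_cond_exp_intg[of "\<lambda>_. 1" "\<lambda>\<omega>. ennreal (Y \<omega>)"] by simp
    then show "(\<integral>\<^sup>+ \<omega>. nn_cond_exp M F (\<lambda>\<omega>. ennreal (Y \<omega>)) \<omega> \<partial>M) \<noteq> \<infinity>"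
      using Y by (simp add: real_integrable_def)
  qed simp
  have "AE \<omega> in M. nn_cond_exp M F (\<lambda>\<omega>. ennreal (- X \<omega>)) \<omega> \<noteq> \<infinity>"
    using X by (intro fin) auto
  with fin[OF X] neg show ?thesis
  proof eventually_elim
    case (elim \<omega>)
    then have "enn2real (nn_cond_exp M F (\<lambda>\<omega>. ennreal (X \<omega>)) \<omega>)
        \<le> enn2real (nn_cond_exp M F (\<lambda>\<omega>. ennreal (- X \<omega>)) \<omega>)"
      by (simp add: real_cond_exp_def)
    with elim(1,3) show ?case
      by (cases "nn_cond_exp M F (\<lambda>\<omega>. ennreal (X \<omega>)) \<omega>" rule: ennreal_cases;
          cases "nn_cond_exp M F (\<lambda>\<omega>. ennreal (- X \<omega>)) \<omega>" rule: ennreal_cases)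
         (auto simp: ennreal_leI)
  qed
qed

text \<open>
  Since \<open>X\<^sup>2\<close> need not be integrable, the negative part of \<open>\<beta> X\<close> is moved to the left, so that all
  terms are nonnegative, and cancelled against the positive part after conditioning.
\<close>
lemma nn_cond_exp_le_parabola:
  assumes X: "integrable M X" and neg: "AE \<omega> in M. real_cond_exp M F X \<omega> \<le> 0"
    and [measurable]: "\<alpha> \<in> borel_measurable F" "\<beta> \<in> borel_measurable F" "\<gamma> \<in> borel_measurable F"
    and [measurable]: "f \<in> borel_measurable M"
    and nonneg: "\<And>\<omega>. \<omega> \<in> space M \<Longrightarrow> 0 \<le> \<alpha> \<omega>" "\<And>\<omega>. \<omega> \<in> space M \<Longrightarrow> 0 \<le> \<beta> \<omega>"
      "\<And>\<omega>. \<omega> \<in> space M \<Longrightarrow> 0 \<le> \<gamma> \<omega>" "\<And>\<omega>. \<omega> \<in> space M \<Longrightarrow> 0 \<le> f \<omega>"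
    and le: "AE \<omega> in M. f \<omega> \<le> \<alpha> \<omega> + \<beta> \<omega> * X \<omega> + \<gamma> \<omega> * (X \<omega>)\<^sup>2"
  shows "AE \<omega> in M. nn_cond_exp M F (\<lambda>\<omega>. ennreal (f \<omega>)) \<omega>
           \<le> ennreal (\<alpha> \<omega>) + ennreal (\<gamma> \<omega>) * nn_cond_exp M F (\<lambda>\<omega>. ennreal ((X \<omega>)\<^sup>2)) \<omega>"
proof -
  let ?N = "nn_cond_exp M F"
  have [measurable]: "X \<in> borel_measurable M" using X by auto
  have [measurable]: "\<alpha> \<in> borel_measurable M" "\<beta> \<in> borel_measurable M" "\<gamma> \<in> borel_measurable M"
    by (auto intro: measurable_from_subalg[OF subalg])
  \<comment> \<open>Since \<open>ennreal\<close> truncates at 0,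
    \<open>ennreal (- X \<omega>)\<close> and \<open>ennreal (X \<omega>)\<close> are the negative
    and positive parts of \<open>X\<close>.\<close>
  define L where "L \<omega> = ennreal (f \<omega>) + ennreal (\<beta> \<omega>) * ennreal (- X \<omega>)" for \<omega>
  define R where "R \<omega> = ennreal (\<alpha> \<omega>) + (ennreal (\<beta> \<omega>) * ennreal (X \<omega>)
      + ennreal (\<gamma> \<omega>) * ennreal ((X \<omega>)\<^sup>2))" for \<omega>
  have "AE \<omega> in M. L \<omega> \<le> R \<omega>"
    using le AE_space
  proof eventually_elim
    case (elim \<omega>)
    note nn = nonneg[OF elim(2)]
    have "L \<omega> = ennreal (f \<omega> + \<beta> \<omega> * max 0 (- X \<omega>))"
      using nn by (simp add: L_def ennreal_mult ennreal_plus max_def ennreal_neg)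
    also have "\<dots> \<le> ennreal (\<alpha> \<omega> + (\<beta> \<omega> * max 0 (X \<omega>) + \<gamma> \<omega> * (X \<omega>)\<^sup>2))"
      using elim by (intro ennreal_leI) (auto simp: max_def)
    also have "\<dots> = R \<omega>"
      using nn by (simp add: R_def ennreal_mult ennreal_plus max_def ennreal_neg)
    finally show ?case .
  qed
  then have mono: "AE \<omega> in M. ?N L \<omega> \<le> ?N R \<omega>"
    by (rule nn_cond_exp_mono) (simp_all add: L_def R_def)
  have NL1: "AE \<omega> in M. ?N (\<lambda>\<omega>. ennreal (f \<omega>)) \<omega> + ?N (\<lambda>\<omega>. ennreal (\<beta> \<omega>) * ennreal (- X \<omega>)) \<omega> = ?N L \<omega>"
    unfolding L_def[abs_def] by (rule nn_cond_exp_sum) auto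
  have NL2: "AE \<omega> in M. ennreal (\<beta> \<omega>) * ?N (\<lambda>\<omega>. ennreal (- X \<omega>)) \<omega>
      = ?N (\<lambda>\<omega>. ennreal (\<beta> \<omega>) * ennreal (- X \<omega>)) \<omega>"
    by (rule nn_cond_exp_prod) auto
  have NR1: "AE \<omega> in M. ?N (\<lambda>\<omega>. ennreal (\<alpha> \<omega>)) \<omega>
      + ?N (\<lambda>\<omega>. ennreal (\<beta> \<omega>) * ennreal (X \<omega>) + ennreal (\<gamma> \<omega>) * ennreal ((X \<omega>)\<^sup>2)) \<omega> = ?N R \<omega>"
    unfolding R_def[abs_def] by (rule nn_cond_exp_sum) auto
  have NR2: "AE \<omega> in M. ennreal (\<alpha> \<omega>) = ?N (\<lambda>\<omega>. ennreal (\<alpha> \<omega>)) \<omega>"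
    by (rule nn_cond_exp_F_meas) auto
  have NR3: "AE \<omega> in M. ?N (\<lambda>\<omega>. ennreal (\<beta> \<omega>) * ennreal (X \<omega>)) \<omega>
      + ?N (\<lambda>\<omega>. ennreal (\<gamma> \<omega>) * ennreal ((X \<omega>)\<^sup>2)) \<omega>
      = ?N (\<lambda>\<omega>. ennreal (\<beta> \<omega>) * ennreal (X \<omega>) + ennreal (\<gamma> \<omega>) * ennreal ((X \<omega>)\<^sup>2)) \<omega>"
    by (rule nn_cond_exp_sum) auto
  have NR4: "AE \<omega> in M. ennreal (\<beta> \<omega>) * ?N (\<lambda>\<omega>. ennreal (X \<omega>)) \<omega>
      = ?N (\<lambda>\<omega>. ennreal (\<beta> \<omega>) * ennreal (X \<omega>)) \<omega>"
    by (rule nn_cond_exp_prod) auto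
  have NR5: "AE \<omega> in M. ennreal (\<gamma> \<omega>) * ?N (\<lambda>\<omega>. ennreal ((X \<omega>)\<^sup>2)) \<omega>
      = ?N (\<lambda>\<omega>. ennreal (\<gamma> \<omega>) * ennreal ((X \<omega>)\<^sup>2)) \<omega>"
    by (rule nn_cond_exp_prod) auto
  from mono NL1 NL2 NR1 NR2 NR3 NR4 NR5 nn_cond_exp_parts_le[OF X neg]
  show ?thesis
  proof eventually_elim
    case (elim \<omega>)
    let ?m = "ennreal (\<beta> \<omega>) * ?N (\<lambda>\<omega>. ennreal (- X \<omega>)) \<omega>"
    have "?m + ?N (\<lambda>\<omega>. ennreal (f \<omega>)) \<omega> \<le> ennreal (\<alpha> \<omega>) +
        (ennreal (\<beta> \<omega>) * ?N (\<lambda>\<omega>. ennreal (X \<omega>)) \<omega> + ennreal (\<gamma> \<omega>) * ?N (\<lambda>\<omega>. ennreal ((X \<omega>)\<^sup>2)) \<omega>)"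
      using elim by (metis add.commute)
    also have "\<dots> \<le> ennreal (\<alpha> \<omega>) + (?m + ennreal (\<gamma> \<omega>) * ?N (\<lambda>\<omega>. ennreal ((X \<omega>)\<^sup>2)) \<omega>)"
      using elim by (intro add_left_mono add_right_mono mult_left_mono) auto
    also have "\<dots> = ?m + (ennreal (\<alpha> \<omega>) + ennreal (\<gamma> \<omega>) * ?N (\<lambda>\<omega>. ennreal ((X \<omega>)\<^sup>2)) \<omega>)"
      by (simp add: ac_simps)
    \<comment> \<open>\<open>?m\<close> can be cancelled because it is finite: a real factor times a
      conditional expectation that is finite by \<open>nn_cond_exp_parts_le\<close>.\<close>
    finally show ?case
      using elim by (subst (asm) ennreal_add_left_cancel_le) (auto simp: ennreal_mult_eq_top_iff less_top)
  qed
qed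

end

lemma exp_ennreal_measurable [measurable]: "exp_ennreal \<in> borel_measurable borel"
  unfolding exp_ennreal_def by measurable

section \<open>A maximal inequality for nonnegative supermartingales\<close>

lemma maximal_inequality:
  fixes Z :: "nat \<Rightarrow> 'a \<Rightarrow> ennreal" and K :: ennreal
  assumes sub: "\<And>k. k \<le> n \<Longrightarrow> subalgebra M (F k)"
    and filt: "\<And>j k. j \<le> k \<Longrightarrow> k \<le> n \<Longrightarrow> sets (F j) \<subseteq> sets (F k)"
    and Z: "\<And>k. k \<le> n \<Longrightarrow> Z k \<in> borel_measurable (F k)"
    and super: "\<And>k A. k < n \<Longrightarrow> A \<in> sets (F k) \<Longrightarrow>
        (\<integral>\<^sup>+ \<omega>. Z (Suc k) \<omega> * indicator A \<omega> \<partial>M) \<le> (\<integral>\<^sup>+ \<omega>. Z k \<omega> * indicator A \<omega> \<partial>M)"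
  shows "{\<omega> \<in> space M. \<exists>k\<le>n. K \<le> Z k \<omega>} \<in> sets M"
    and "K * emeasure M {\<omega> \<in> space M. \<exists>k\<le>n. K \<le> Z k \<omega>} \<le> (\<integral>\<^sup>+ \<omega>. Z 0 \<omega> \<partial>M)"
proof -
  define B where "B k = {\<omega> \<in> space M. \<exists>j\<le>k. K \<le> Z j \<omega>}" for k
  have sp: "space (F k) = space M" if "k \<le> n" for k
    using sub[OF that] by (simp add: subalgebra_def)
  have B: "B k \<in> sets (F k)" if k: "k \<le> n" for k
  proof -
    have "{\<omega> \<in> space M. K \<le> Z j \<omega>} \<in> sets (F k)" if "j \<le> k" for j
    proof -
      have [measurable]: "Z j \<in> borel_measurable (F j)" using Z that k by simp
      have "{\<omega> \<in> space (F j). K \<le> Z j \<omega>} \<in> sets (F j)" by measurable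
      then show ?thesis using filt[OF that k] sp[of j] that k by auto
    qed
    then have "(\<Union>j\<in>{..k}. {\<omega> \<in> space M. K \<le> Z j \<omega>}) \<in> sets (F k)"
      by (intro sets.finite_UN) auto
    also have "(\<Union>j\<in>{..k}. {\<omega> \<in> space M. K \<le> Z j \<omega>}) = B k" by (auto simp: B_def)
    finally show ?thesis .
  qed
  have BM: "B k \<in> sets M" if "k \<le> n" for k
    using B[OF that] sub[OF that] by (auto simp: subalgebra_def)
  have ZM: "Z k \<in> borel_measurable M" if "k \<le> n" for k
    using Z[OF that] sub[OF that] by (rule measurable_from_subalg[rotated])
  have inv: "(\<integral>\<^sup>+ \<omega>. K * indicator (B k) \<omega> + Z k \<omega> * indicator (space M - B k) \<omega> \<partial>M)
      \<le> (\<integral>\<^sup>+ \<omega>. Z 0 \<omega> \<partial>M)" if "k \<le> n" for k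
    using that
  proof (induction k)
    case 0
    show ?case
      by (intro nn_integral_mono) (auto simp: B_def indicator_def)
  next
    case (Suc k)
    have [measurable]: "B k \<in> sets M" "Z k \<in> borel_measurable M" "Z (Suc k) \<in> borel_measurable M"
      using BM[of k] ZM[of k] ZM[of "Suc k"] Suc.prems by auto
    \<comment> \<open>On points of \<open>B (Suc k)\<close> outside \<open>B k\<close>,
      \<open>K \<le> Z (Suc k) \<omega>\<close>, so putting \<open>Z (Suc k)\<close> in place of
      \<open>K\<close> there only enlarges the integrand.\<close>
    have "(\<integral>\<^sup>+ \<omega>. K * indicator (B (Suc k)) \<omega> + Z (Suc k) \<omega> * indicator (space M - B (Suc k)) \<omega> \<partial>M)
        \<le> (\<integral>\<^sup>+ \<omega>. K * indicator (B k) \<omega> + Z (Suc k) \<omega> * indicator (space M - B k) \<omega> \<partial>M)"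
      by (intro nn_integral_mono) (auto simp: B_def indicator_def le_Suc_eq)
    also have "\<dots> = (\<integral>\<^sup>+ \<omega>. K * indicator (B k) \<omega> \<partial>M)
        + (\<integral>\<^sup>+ \<omega>. Z (Suc k) \<omega> * indicator (space M - B k) \<omega> \<partial>M)"
      by (rule nn_integral_add) auto
    also have "\<dots> \<le> (\<integral>\<^sup>+ \<omega>. K * indicator (B k) \<omega> \<partial>M)
        + (\<integral>\<^sup>+ \<omega>. Z k \<omega> * indicator (space M - B k) \<omega> \<partial>M)"
    proof (intro add_left_mono super)
      show "space M - B k \<in> sets (F k)"
        using sets.compl_sets[OF B[of k]] Suc.prems sp[of k] by simp
    qed (use Suc.prems in simp)
    also have "\<dots> = (\<integral>\<^sup>+ \<omega>. K * indicator (B k) \<omega> + Z k \<omega> * indicator (space M - B k) \<omega> \<partial>M)"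
      by (rule nn_integral_add[symmetric]) auto
    also have "\<dots> \<le> (\<integral>\<^sup>+ \<omega>. Z 0 \<omega> \<partial>M)" using Suc by simp
    finally show ?case .
  qed
  show "{\<omega> \<in> space M. \<exists>k\<le>n. K \<le> Z k \<omega>} \<in> sets M"
    using BM[OF order_refl] unfolding B_def .
  have "K * emeasure M (B n) = (\<integral>\<^sup>+ \<omega>. K * indicator (B n) \<omega> \<partial>M)"
    using BM[OF order_refl] by (simp add: nn_integral_cmult_indicator)
  also have "\<dots> \<le> (\<integral>\<^sup>+ \<omega>. K * indicator (B n) \<omega> + Z n \<omega> * indicator (space M - B n) \<omega> \<partial>M)"
    by (intro nn_integral_mono) simp
  also have "\<dots> \<le> (\<integral>\<^sup>+ \<omega>. Z 0 \<omega> \<partial>M)" by (rule inv) simp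
  finally show "K * emeasure M {\<omega> \<in> space M. \<exists>k\<le>n. K \<le> Z k \<omega>} \<le> (\<integral>\<^sup>+ \<omega>. Z 0 \<omega> \<partial>M)"
    unfolding B_def .
qed


lemma exp_ennreal_ennreal: "0 \<le> r \<Longrightarrow> exp_ennreal (ennreal r) = ennreal (exp r)"
  by (simp add: exp_ennreal_def)

text \<open>Equality fails only at infinity, where the product is 0 times infinity, that is
  0.\<close>

lemma inverse_exp_ennreal_mult_le: "inverse (exp_ennreal t) * exp_ennreal t \<le> 1"
  by (cases t rule: ennreal_cases)
     (auto simp: exp_ennreal_def inverse_ennreal ennreal_mult[symmetric])

section \<open>The conditional exponential moment of one difference\<close>

lemma C_sq_measurable:
  assumes [measurable]: "U j \<in> borel_measurable (F j)"
  shows "C_sq M F \<xi> U j \<in> borel_measurable (F j)"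
proof -
  have [measurable]: "cond_second_moment M F \<xi> (j + 1) \<in> borel_measurable (F j)"
    by (simp add: cond_second_moment_def)
  show ?thesis
    unfolding C_sq_def[abs_def] by measurable
qed

text \<open>The points \<open>- a\<close> and \<open>b\<close> depend on \<omega> only through
  \<open>U j\<close> and the conditional second moment, so the coefficients of the parabola are
  measurable with respect to \<open>F j\<close>. Where the second moment is infinite, so is the
  right side.\<close>

lemma nn_cond_exp_exp_le:
  assumes "sigma_finite_subalgebra M (F j)"
    and X: "integrable M (\<xi> (j + 1))" and neg: "AE \<omega> in M. real_cond_exp M (F j) (\<xi> (j + 1)) \<omega> \<le> 0"
    and [measurable]: "U j \<in> borel_measurable (F j)"
    and U: "\<And>\<omega>. \<omega> \<in> space M \<Longrightarrow> 0 \<le> U j \<omega>" and bound: "AE \<omega> in M. \<xi> (j + 1) \<omega> \<le> U j \<omega>"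
    and l: "0 < l"
  shows "AE \<omega> in M. nn_cond_exp M (F j) (\<lambda>\<omega>. ennreal (exp (l * \<xi> (j + 1) \<omega>))) \<omega>
           \<le> exp_ennreal (ennreal (l\<^sup>2 / 2) * C_sq M F \<xi> U j \<omega>)"
proof -
  interpret sigma_finite_subalgebra M "F j" by fact
  let ?X = "\<xi> (j + 1)"
  have [measurable]: "?X \<in> borel_measurable M" using X by auto
  define \<sigma> where "\<sigma> = cond_second_moment M F \<xi> (j + 1)"
  have \<sigma>: "\<sigma> = nn_cond_exp M (F j) (\<lambda>\<omega>. ennreal ((?X \<omega>)\<^sup>2))"
    by (simp add: \<sigma>_def cond_second_moment_def fun_eq_iff)
  have [measurable]: "\<sigma> \<in> borel_measurable (F j)" by (simp add: \<sigma>)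
  \<comment> \<open>Where \<open>\<sigma>\<close> is infinite this sets \<open>s\<close> to 0. The
    pointwise parabola bound survives there, as it uses only
    \<open>?X \<omega> \<le> b \<omega>\<close> and the signs of \<open>a\<close> and
    \<open>b\<close>.\<close>
  define s where "s \<omega> = enn2real (\<sigma> \<omega>)" for \<omega>
  define b where "b \<omega> = max (U j \<omega>) (sqrt (s \<omega>))" for \<omega>
  define a where "a \<omega> = s \<omega> / b \<omega>" for \<omega>
  define h where "h \<omega> = l * (a \<omega> + b \<omega>)" for \<omega>
  define q where "q \<omega> = exp_remainder (h \<omega>)" for \<omega>
  \<comment> \<open>These are the coefficients in powers of \<open>?X \<omega>\<close> of
    \<open>exp (- (l * a \<omega>)) * (1 + y + y\<^sup>2 * q \<omega>)\<close> with
    \<open>y = l * (?X \<omega> + a \<omega>)\<close>.\<close>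
  define \<alpha> where "\<alpha> \<omega> = exp (- (l * a \<omega>)) * (1 + l * a \<omega> + l\<^sup>2 * (a \<omega>)\<^sup>2 * q \<omega>)" for \<omega>
  define \<beta> where "\<beta> \<omega> = exp (- (l * a \<omega>)) * (l + 2 * l\<^sup>2 * a \<omega> * q \<omega>)" for \<omega>
  define \<gamma> where "\<gamma> \<omega> = exp (- (l * a \<omega>)) * l\<^sup>2 * q \<omega>" for \<omega>
  have [measurable]: "s \<in> borel_measurable (F j)" unfolding s_def[abs_def] by measurable
  have [measurable]: "b \<in> borel_measurable (F j)" unfolding b_def[abs_def] by measurable
  have [measurable]: "a \<in> borel_measurable (F j)" unfolding a_def[abs_def] by measurable
  have [measurable]: "h \<in> borel_measurable (F j)" unfolding h_def[abs_def] by measurable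
  have [measurable]: "q \<in> borel_measurable (F j)" unfolding q_def[abs_def] by measurable
  have meas: "\<alpha> \<in> borel_measurable (F j)" "\<beta> \<in> borel_measurable (F j)" "\<gamma> \<in> borel_measurable (F j)"
    unfolding \<alpha>_def[abs_def] \<beta>_def[abs_def] \<gamma>_def[abs_def] by measurable
  have exp_meas: "(\<lambda>\<omega>. exp (l * ?X \<omega>)) \<in> borel_measurable M" by measurable
  have s: "0 \<le> s \<omega>" for \<omega> by (simp add: s_def)
  have b: "0 \<le> b \<omega>" for \<omega> using s[of \<omega>] by (simp add: b_def le_max_iff_disj)
  have a: "0 \<le> a \<omega>" for \<omega> using s b by (simp add: a_def)
  have q: "0 \<le> q \<omega>" for \<omega> by (simp add: q_def exp_remainder_nonneg)
  have ab: "s \<omega> = a \<omega> * b \<omega>" for \<omega>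
  proof (cases "b \<omega> = 0")
    case True
    then have "sqrt (s \<omega>) \<le> 0" by (simp add: b_def max_def split: if_splits)
    with s[of \<omega>] True show ?thesis by simp
  qed (simp add: a_def)
  have "AE \<omega> in M. exp (l * ?X \<omega>) \<le> \<alpha> \<omega> + \<beta> \<omega> * ?X \<omega> + \<gamma> \<omega> * (?X \<omega>)\<^sup>2"
    using bound
  proof eventually_elim
    case (elim \<omega>)
    \<comment> \<open>The shift moves the tangency point \<open>- a\<close> to 0 and the endpoint
      \<open>b\<close> to \<open>h\<close>.\<close>
    define y where "y = l * (?X \<omega> + a \<omega>)"
    have "?X \<omega> \<le> b \<omega>" using elim by (simp add: b_def)
    then have "exp y \<le> 1 + y + y\<^sup>2 * q \<omega>"
      unfolding q_def using a b l by (intro exp_le_parabola) (auto simp: h_def y_def)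
    then have "exp (- (l * a \<omega>)) * exp y \<le> exp (- (l * a \<omega>)) * (1 + y + y\<^sup>2 * q \<omega>)"
      by (intro mult_left_mono) auto
    moreover have "exp (- (l * a \<omega>)) * exp y = exp (l * ?X \<omega>)"
      by (simp add: y_def exp_add[symmetric] algebra_simps)
    moreover have "exp (- (l * a \<omega>)) * (1 + y + y\<^sup>2 * q \<omega>) = \<alpha> \<omega> + \<beta> \<omega> * ?X \<omega> + \<gamma> \<omega> * (?X \<omega>)\<^sup>2"
      by (simp add: \<alpha>_def \<beta>_def \<gamma>_def y_def algebra_simps power2_eq_square)
    ultimately show ?case by simp
  qed
  then have "AE \<omega> in M. nn_cond_exp M (F j) (\<lambda>\<omega>. ennreal (exp (l * ?X \<omega>))) \<omega>
      \<le> ennreal (\<alpha> \<omega>) + ennreal (\<gamma> \<omega>) * nn_cond_exp M (F j) (\<lambda>\<omega>. ennreal ((?X \<omega>)\<^sup>2)) \<omega>"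
    using a q l by (intro nn_cond_exp_le_parabola[OF X neg meas exp_meas]) (auto simp: \<alpha>_def \<beta>_def \<gamma>_def)
  then show ?thesis
    using AE_space
  proof eventually_elim
    case (elim \<omega>)
    show ?case
    proof (cases "\<sigma> \<omega> = \<infinity>")
      case True
      then have "C_sq M F \<xi> U j \<omega> = \<infinity>" unfolding \<sigma>_def C_sq_def by simp
      then show ?thesis using l by (simp add: exp_ennreal_def ennreal_mult_eq_top_iff)
    next
      case False
      then have \<sigma>s: "\<sigma> \<omega> = ennreal (s \<omega>)" by (simp add: s_def less_top)
      have "C_sq M F \<xi> U j \<omega> = ennreal ((a \<omega> + b \<omega>)\<^sup>2 / 4)"
        using C_sq_eq[of M F \<xi> j \<omega> "s \<omega>" U] \<sigma>s s U[OF elim(2)]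
        by (simp add: \<sigma>_def a_def b_def)
      then have C: "exp_ennreal (ennreal (l\<^sup>2 / 2) * C_sq M F \<xi> U j \<omega>) = ennreal (exp ((h \<omega>)\<^sup>2 / 8))"
        by (simp add: h_def ennreal_mult[symmetric] exp_ennreal_ennreal power_mult_distrib)
      have "nn_cond_exp M (F j) (\<lambda>\<omega>. ennreal (exp (l * ?X \<omega>))) \<omega>
          \<le> ennreal (\<alpha> \<omega>) + ennreal (\<gamma> \<omega>) * ennreal (s \<omega>)"
        using elim(1) \<sigma>s by (simp add: \<sigma>)
      also have "\<dots> = ennreal (\<alpha> \<omega> + \<gamma> \<omega> * s \<omega>)"
        using a q s l by (simp add: \<alpha>_def \<gamma>_def ennreal_mult ennreal_plus)
      also have "\<dots> \<le> ennreal (exp ((h \<omega>)\<^sup>2 / 8))"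
        unfolding \<alpha>_def \<gamma>_def q_def h_def
        by (intro ennreal_leI parabola_mean_le a b ab l)
      finally show ?thesis using C by simp
    qed
  qed
qed

section \<open>The exponential supermartingale and the tail bound\<close>

text \<open>The event enters only through an almost sure inclusion, so that one lemma serves both
  tail bounds, including the one whose hypothesis on second moments holds only almost
  surely.\<close>

lemma subgaussian_tail:
  fixes V :: "nat \<Rightarrow> 'a \<Rightarrow> ennreal" and \<xi> :: "nat \<Rightarrow> 'a \<Rightarrow> real"
  assumes prob: "prob_space M"
    and sub: "\<And>k. k \<le> n \<Longrightarrow> subalgebra M (F k)"
    and filt: "\<And>k. k < n \<Longrightarrow> sets (F k) \<subseteq> sets (F (Suc k))"
    and \<xi>: "\<And>k. k < n \<Longrightarrow> \<xi> (Suc k) \<in> borel_measurable (F (Suc k))"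
    and V: "\<And>k. k < n \<Longrightarrow> V k \<in> borel_measurable (F k)"
    and mgf: "\<And>l k. 0 < l \<Longrightarrow> k < n \<Longrightarrow>
        AE \<omega> in M. nn_cond_exp M (F k) (\<lambda>\<omega>. ennreal (exp (l * \<xi> (Suc k) \<omega>))) \<omega>
          \<le> exp_ennreal (ennreal (l\<^sup>2 / 2) * V k \<omega>)"
    and x: "0 < x" and v: "0 < v"
    and E: "AE \<omega> in M. \<omega> \<in> E \<longrightarrow>
        (\<exists>k\<le>n. x \<le> (\<Sum>i<k. \<xi> (Suc i) \<omega>) \<and> (\<Sum>i<k. V i \<omega>) \<le> ennreal (v\<^sup>2))"
  shows "measure M E \<le> exp (- (x\<^sup>2 / (2 * v\<^sup>2)))"
proof -
  interpret prob_space M by fact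
  \<comment> \<open>This \<open>l\<close> maximises
    \<open>l * x - l\<^sup>2 / 2 * v\<^sup>2\<close>; the maximum is the exponent in
    \<open>K\<close>.\<close>
  define l where "l = x / v\<^sup>2"
  have l: "0 < l" using x v by (simp add: l_def)
  define K where "K = exp (x\<^sup>2 / (2 * v\<^sup>2))"
  \<comment> \<open>A reciprocal in \<open>ennreal\<close> is 0 where \<open>V k\<close> is
    infinite, so \<open>Z\<close> drops to 0 there and no difference of infinities arises.\<close>
  define D where "D k \<omega> = inverse (exp_ennreal (ennreal (l\<^sup>2 / 2) * V k \<omega>))" for k \<omega>
  define Z where "Z k \<omega> = (\<Prod>i<k. ennreal (exp (l * \<xi> (Suc i) \<omega>)) * D i \<omega>)" for k \<omega>
  have filt': "sets (F j) \<subseteq> sets (F k)" if "j \<le> k" "k \<le> n" for j k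
    using that by (induction k rule: dec_induct) (auto intro!: subsetD[OF filt])
  have sub': "subalgebra (F k) (F j)" if "j \<le> k" "k \<le> n" for j k
    using filt'[OF that] sub[of j] sub[of k] that by (simp add: subalgebra_def)
  have D: "D k \<in> borel_measurable (F k)" if "k < n" for k
  proof -
    have [measurable]: "V k \<in> borel_measurable (F k)" using that by (rule V)
    show ?thesis unfolding D_def[abs_def] by measurable
  qed
  have Z: "Z k \<in> borel_measurable (F k)" if k: "k \<le> n" for k
  proof -
    have "(\<lambda>\<omega>. ennreal (exp (l * \<xi> (Suc i) \<omega>)) * D i \<omega>) \<in> borel_measurable (F k)" if i: "i < k" for i
    proof -
      have [measurable]: "\<xi> (Suc i) \<in> borel_measurable (F k)"
        by (rule measurable_from_subalg[OF sub' \<xi>]) (use i k in auto)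
      have [measurable]: "D i \<in> borel_measurable (F k)"
        by (rule measurable_from_subalg[OF sub' D]) (use i k in auto)
      show ?thesis by measurable
    qed
    then show ?thesis unfolding Z_def[abs_def] by (intro borel_measurable_prod_ennreal) auto
  qed
  have super: "(\<integral>\<^sup>+ \<omega>. Z (Suc k) \<omega> * indicator A \<omega> \<partial>M) \<le> (\<integral>\<^sup>+ \<omega>. Z k \<omega> * indicator A \<omega> \<partial>M)"
    if k: "k < n" and A: "A \<in> sets (F k)" for k A
  proof -
    interpret fk: finite_measure_subalgebra M "F k"
      by standard (use sub k in auto)
    let ?X = "\<lambda>\<omega>. ennreal (exp (l * \<xi> (Suc k) \<omega>))"
    have [measurable]: "\<xi> (Suc k) \<in> borel_measurable M"
      by (rule measurable_from_subalg[OF sub \<xi>]) (use k in auto)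
    have [measurable]: "Z k \<in> borel_measurable (F k)" "D k \<in> borel_measurable (F k)" "A \<in> sets (F k)"
      using k A Z D by auto
    \<comment> \<open>All factors except the new exponential are measurable with respect to
      \<open>F k\<close>, so only that one is replaced by its conditional expectation.\<close>
    have "(\<integral>\<^sup>+ \<omega>. Z (Suc k) \<omega> * indicator A \<omega> \<partial>M) = (\<integral>\<^sup>+ \<omega>. (Z k \<omega> * D k \<omega> * indicator A \<omega>) * ?X \<omega> \<partial>M)"
      by (simp add: Z_def ac_simps)
    also have "\<dots> = (\<integral>\<^sup>+ \<omega>. (Z k \<omega> * D k \<omega> * indicator A \<omega>) * nn_cond_exp M (F k) ?X \<omega> \<partial>M)"
      by (rule fk.nn_cond_exp_intg[symmetric]) auto
    also have "\<dots> \<le> (\<integral>\<^sup>+ \<omega>. Z k \<omega> * indicator A \<omega> \<partial>M)"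
    proof (rule nn_integral_mono_AE)
      show "AE \<omega> in M. (Z k \<omega> * D k \<omega> * indicator A \<omega>) * nn_cond_exp M (F k) ?X \<omega> \<le> Z k \<omega> * indicator A \<omega>"
        using mgf[OF l k]
      proof eventually_elim
        case (elim \<omega>)
        have "D k \<omega> * nn_cond_exp M (F k) ?X \<omega> \<le> D k \<omega> * exp_ennreal (ennreal (l\<^sup>2 / 2) * V k \<omega>)"
          using elim by (intro mult_left_mono) auto
        also have "\<dots> \<le> 1" unfolding D_def by (rule inverse_exp_ennreal_mult_le)
        finally have "(Z k \<omega> * indicator A \<omega>) * (D k \<omega> * nn_cond_exp M (F k) ?X \<omega>) \<le> (Z k \<omega> * indicator A \<omega>) * 1"
          by (intro mult_left_mono) auto
        then show ?case by (simp add: ac_simps)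
      qed
    qed
    finally show ?thesis .
  qed
  define B where "B = {\<omega> \<in> space M. \<exists>k\<le>n. ennreal K \<le> Z k \<omega>}"
  have B: "B \<in> sets M"
    unfolding B_def by (rule maximal_inequality(1)[of n M F Z]) (fact sub filt' Z super)+
  have "ennreal K * emeasure M B \<le> (\<integral>\<^sup>+ \<omega>. Z 0 \<omega> \<partial>M)"
    unfolding B_def by (rule maximal_inequality(2)[of n M F Z]) (fact sub filt' Z super)+
  \<comment> \<open>\<open>Z 0\<close> is an empty product, so its integral is 1.\<close>
  then have KB: "K * measure M B \<le> 1"
    by (simp add: Z_def emeasure_eq_measure prob_space ennreal_mult[symmetric] K_def)
  have "AE \<omega> in M. \<omega> \<in> E \<longrightarrow> \<omega> \<in> B"
    using E AE_space
  proof eventually_elim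
    case (elim \<omega>)
    show ?case
    proof
      assume "\<omega> \<in> E"
      with elim obtain k where k: "k \<le> n" "x \<le> (\<Sum>i<k. \<xi> (Suc i) \<omega>)"
        and sum: "(\<Sum>i<k. V i \<omega>) \<le> ennreal (v\<^sup>2)" by blast
      define r where "r i = enn2real (V i \<omega>)" for i
      have r: "0 \<le> r i" for i by (simp add: r_def)
      \<comment> \<open>The bound on the sum makes each summand finite, so from here on the
        exponents are real numbers.\<close>
      have "V i \<omega> \<noteq> \<infinity>" if "i < k" for i
      proof -
        have "V i \<omega> \<le> (\<Sum>i<k. V i \<omega>)" using that by (intro member_le_sum) auto
        also note sum
        finally show ?thesis by (auto simp: top_unique)
      qed
      then have Vr: "V i \<omega> = ennreal (r i)" if "i < k" for i
        using that by (simp add: r_def less_top)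
      have "ennreal (\<Sum>i<k. r i) \<le> ennreal (v\<^sup>2)"
        using sum r by (simp add: Vr sum_ennreal)
      then have rv: "(\<Sum>i<k. r i) \<le> v\<^sup>2" by simp
      have "D i \<omega> = ennreal (exp (- (l\<^sup>2 / 2 * r i)))" if "i < k" for i
        unfolding D_def Vr[OF that]
        using r[of i] by (simp add: ennreal_mult[symmetric] exp_ennreal_ennreal inverse_ennreal exp_minus
            del: times_divide_eq_left)
      then have "Z k \<omega> = (\<Prod>i<k. ennreal (exp (l * \<xi> (Suc i) \<omega> - l\<^sup>2 / 2 * r i)))"
        unfolding Z_def
        by (intro prod.cong) (auto simp: ennreal_mult[symmetric] mult_exp_exp simp del: times_divide_eq_left)
      also have "\<dots> = ennreal (exp (\<Sum>i<k. l * \<xi> (Suc i) \<omega> - l\<^sup>2 / 2 * r i))"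
        by (simp add: prod_ennreal exp_sum)
      also have "(\<Sum>i<k. l * \<xi> (Suc i) \<omega> - l\<^sup>2 / 2 * r i)
          = l * (\<Sum>i<k. \<xi> (Suc i) \<omega>) - l\<^sup>2 / 2 * (\<Sum>i<k. r i)"
        by (simp add: sum_subtractf sum_distrib_left)
      finally have Zk: "Z k \<omega> = ennreal (exp (l * (\<Sum>i<k. \<xi> (Suc i) \<omega>) - l\<^sup>2 / 2 * (\<Sum>i<k. r i)))" .
      have "x\<^sup>2 / (2 * v\<^sup>2) = l * x - l\<^sup>2 / 2 * v\<^sup>2"
        using v by (simp add: l_def field_simps power2_eq_square)
      also have "\<dots> \<le> l * (\<Sum>i<k. \<xi> (Suc i) \<omega>) - l\<^sup>2 / 2 * (\<Sum>i<k. r i)"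
        using k(2) rv l by (intro diff_mono mult_left_mono) auto
      finally have "ennreal K \<le> Z k \<omega>"
        unfolding Zk K_def by (intro ennreal_leI) simp
      with k(1) elim(2) show "\<omega> \<in> B" by (auto simp: B_def)
    qed
  qed
  then have "measure M E \<le> measure M B"
    using emeasure_mono_AE[OF _ B, of E] by (simp add: emeasure_eq_measure)
  also have "\<dots> \<le> 1 / K"
    using KB by (simp add: K_def field_simps)
  finally show ?thesis by (simp add: K_def exp_minus field_simps)
qed

section \<open>Derivation of the three conclusions\<close>

theorem corollary2p7:
  fixes M :: "'a measure" and n :: nat
    and F :: "nat \<Rightarrow> 'a measure" and \<xi> U :: "nat \<Rightarrow> 'a \<Rightarrow> real"
  assumes n: "n \<ge> 1"
    and smd: "supermartingale_differences M n F \<xi>"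
    and U_meas: "\<And>i. i \<in> {1..n} \<Longrightarrow> U (i - 1) \<in> borel_measurable (F (i - 1))"
    and U_nonneg: "\<And>i \<omega>. i \<in> {1..n} \<Longrightarrow> \<omega> \<in> space M \<Longrightarrow> 0 \<le> U (i - 1) \<omega>"
    and bound: "\<And>i. i \<in> {1..n} \<Longrightarrow> AE \<omega> in M. \<xi> i \<omega> \<le> U (i - 1) \<omega>"
  shows "(\<forall>l>0. \<forall>i\<in>{1..n}. AE \<omega> in M.
            nn_cond_exp M (F (i - 1)) (\<lambda>\<omega>. ennreal (exp (l * \<xi> i \<omega>))) \<omega>
              \<le> exp_ennreal (ennreal (l\<^sup>2 / 2) * C_sq M F \<xi> U (i - 1) \<omega>))
       \<and> (\<forall>x>0. \<forall>v>0.
            measure M {\<omega> \<in> space M. \<exists>k\<in>{1..n}.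
                partial_sum \<xi> k \<omega> \<ge> x \<and>
                (\<Sum>i=1..k. C_sq M F \<xi> U (i - 1) \<omega>) \<le> ennreal (v\<^sup>2)}
              \<le> exp (- (x\<^sup>2 / (2 * v\<^sup>2))))
       \<and> ((\<forall>i\<in>{1..n}. AE \<omega> in M.
              cond_second_moment M F \<xi> i \<omega> \<ge> ennreal ((U (i - 1) \<omega>)\<^sup>2)) \<longrightarrow>
          (\<forall>x\<ge>0. \<forall>v>0.
            measure M {\<omega> \<in> space M.
                (MAX k\<in>{1..n}. partial_sum \<xi> k \<omega>) \<ge> x \<and>
                quad_char M F \<xi> n \<omega> \<le> ennreal (v\<^sup>2)}
              \<le> exp (- (x\<^sup>2 / (2 * v\<^sup>2)))))"
proof -
  from smd interpret prob_space M by (simp add: supermartingale_differences_def)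
  have sub: "subalgebra M (F k)" if "k \<le> n" for k
    using smd that by (simp add: supermartingale_differences_def)
  have filt: "sets (F k) \<subseteq> sets (F (Suc k))" if "k < n" for k
    using smd that by (simp add: supermartingale_differences_def)
  have \<xi>_meas: "\<xi> k \<in> borel_measurable (F k)" if "k \<le> n" for k
    using smd that by (simp add: supermartingale_differences_def)
  have \<xi>: "integrable M (\<xi> i)" "AE \<omega> in M. real_cond_exp M (F (i - 1)) (\<xi> i) \<omega> \<le> 0"
    if "i \<in> {1..n}" for i
    using smd that unfolding supermartingale_differences_def by blast+
  have mgf: "AE \<omega> in M. nn_cond_exp M (F k) (\<lambda>\<omega>. ennreal (exp (l * \<xi> (Suc k) \<omega>))) \<omega>
      \<le> exp_ennreal (ennreal (l\<^sup>2 / 2) * C_sq M F \<xi> U k \<omega>)" if l: "0 < l" and k: "k < n" for l k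
  proof -
    interpret fk: finite_measure_subalgebra M "F k"
      by standard (use sub k in auto)
    have i: "Suc k \<in> {1..n}" using k by simp
    show ?thesis
      using nn_cond_exp_exp_le[of M F k \<xi> U l] fk.sigma_finite_subalgebra_axioms l
        \<xi>[OF i] U_meas[OF i] U_nonneg[OF i] bound[OF i] by simp
  qed
  have tail: "measure M E \<le> exp (- (x\<^sup>2 / (2 * v\<^sup>2)))"
    if x: "0 < x" and v: "0 < v" and E: "AE \<omega> in M. \<omega> \<in> E \<longrightarrow> (\<exists>k\<in>{1..n}. x \<le> partial_sum \<xi> k \<omega> \<and>
        (\<Sum>i=1..k. C_sq M F \<xi> U (i - 1) \<omega>) \<le> ennreal (v\<^sup>2))" for E x v
  proof (rule subgaussian_tail[where n = n and F = F and \<xi> = \<xi> and V = "C_sq M F \<xi> U"])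
    show "C_sq M F \<xi> U k \<in> borel_measurable (F k)" if "k < n" for k
      using U_meas[of "Suc k"] that by (intro C_sq_measurable) simp
    show "AE \<omega> in M. \<omega> \<in> E \<longrightarrow> (\<exists>k\<le>n. x \<le> (\<Sum>i<k. \<xi> (Suc i) \<omega>)
        \<and> (\<Sum>i<k. C_sq M F \<xi> U i \<omega>) \<le> ennreal (v\<^sup>2))"
      using E
      by eventually_elim (auto simp: partial_sum_def sum.atLeast1_atMost_eq)
  qed (use prob_space_axioms sub filt \<xi>_meas mgf x v in auto)
  show ?thesis
  proof (intro conjI allI impI ballI)
    fix l :: real and i assume "0 < l" "i \<in> {1..n}"
    then have "0 < l" "i - 1 < n" "Suc (i - 1) = i" by auto
    with mgf[of l "i - 1"] show "AE \<omega> in M. nn_cond_exp M (F (i - 1)) (\<lambda>\<omega>. ennreal (exp (l * \<xi> i \<omega>))) \<omega>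
        \<le> exp_ennreal (ennreal (l\<^sup>2 / 2) * C_sq M F \<xi> U (i - 1) \<omega>)"
      by (simp only:)
  next
    fix x v :: real assume "0 < x" "0 < v"
    then show "measure M {\<omega> \<in> space M. \<exists>k\<in>{1..n}. partial_sum \<xi> k \<omega> \<ge> x \<and>
        (\<Sum>i=1..k. C_sq M F \<xi> U (i - 1) \<omega>) \<le> ennreal (v\<^sup>2)} \<le> exp (- (x\<^sup>2 / (2 * v\<^sup>2)))"
      by (rule tail) auto
  next
    fix x v :: real
    assume large: "\<forall>i\<in>{1..n}. AE \<omega> in M. cond_second_moment M F \<xi> i \<omega> \<ge> ennreal ((U (i - 1) \<omega>)\<^sup>2)"
      and "0 \<le> x" and v: "0 < v"
    let ?E = "{\<omega> \<in> space M. (MAX k\<in>{1..n}. partial_sum \<xi> k \<omega>) \<ge> x \<and> quad_char M F \<xi> n \<omega> \<le> ennreal (v\<^sup>2)}"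
    show "measure M ?E \<le> exp (- (x\<^sup>2 / (2 * v\<^sup>2)))"
    \<comment> \<open>The tail bound is available for positive \<open>x\<close> only; at
      \<open>x = 0\<close> the right side is 1.\<close>
    proof (cases "x = 0")
      case True
      then show ?thesis by simp
    next
      case False
      with \<open>0 \<le> x\<close> have x: "0 < x" by simp
      have "AE \<omega> in M. \<forall>i\<in>{1..n}. cond_second_moment M F \<xi> i \<omega> \<ge> ennreal ((U (i - 1) \<omega>)\<^sup>2)"
        using large by (intro AE_finite_allI) auto
      then have "AE \<omega> in M. \<omega> \<in> ?E \<longrightarrow> (\<exists>k\<in>{1..n}. x \<le> partial_sum \<xi> k \<omega> \<and>
          (\<Sum>i=1..k. C_sq M F \<xi> U (i - 1) \<omega>) \<le> ennreal (v\<^sup>2))"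
      proof eventually_elim
        case (elim \<omega>)
        show ?case
        proof
          assume \<omega>: "\<omega> \<in> ?E"
          then obtain k where k: "k \<in> {1..n}" "x \<le> partial_sum \<xi> k \<omega>"
            using n by (auto simp: Max_ge_iff)
          \<comment> \<open>Here every term is in the first branch of \<open>C_sq\<close>, so the
            sum is the quadratic characteristic at \<open>k\<close>, which is at most that at
            \<open>n\<close>.\<close>
          have "(\<Sum>i=1..k. C_sq M F \<xi> U (i - 1) \<omega>) = (\<Sum>i=1..k. cond_second_moment M F \<xi> i \<omega>)"
            using elim k(1) by (intro sum.cong) (auto simp: C_sq_def)
          also have "\<dots> \<le> quad_char M F \<xi> n \<omega>"
            unfolding quad_char_def using k(1) by (intro sum_mono2) auto
          also have "\<dots> \<le> ennreal (v\<^sup>2)" using \<omega> by simp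
          finally show "\<exists>k\<in>{1..n}. x \<le> partial_sum \<xi> k \<omega> \<and>
              (\<Sum>i=1..k. C_sq M F \<xi> U (i - 1) \<omega>) \<le> ennreal (v\<^sup>2)"
            using k by blast
        qed
      qed
      then show ?thesis by (rule tail[OF x v])
    qed
  qed
qed

end
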